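(* Consider the planar dumbbell/point mass problem with parameters $x_1,x_2\in(0,1)$, $x_1+x_2=1$, and $M_1,M_2\in(0,1)$, $M_1+M_2=1$. Consider colinear non-overlapped relative equilibria, that is, relative equilibria with $\theta=0$ and $r>x_2$. Then for all sufficiently low angular momenta $L\ge 0$ there are no such relative equilibria, and there is a value $L_b>0$ such that for every angular momentum $L>L_b$ there are exactly two such relative equilibria.
   Context: Planar dumbbell/point mass problem: a point mass body of mass $M_1$ and a dumbbell of total mass $M_2$ (with $M_1+M_2=1$) move in a plane under Newtonian gravity ($G=1$). The dumbbell consists of two point masses $M_2x_1$, $M_2x_2$ ($x_1+x_2=1$, $x_i>0$) joined by a massless rod of length $1$. Let $\vec r$ be the vector from the point mass body to the dumbbell's center of mass, $r=|\vec r|>0$, and let $\theta$ be the angle between $\vec r$ and the rod, where for $\theta=0$ the mass $x_1$ is the one on the side of the point mass body. The distances from the point mass body to the two dumbbell masses are $$d_1=\sqrt{r^2-2x_2r\cos\theta+x_2^2},\qquad d_2=\sqrt{r^2+2x_1r\cos\theta+x_1^2}.$$ Put $B=\frac{x_1x_2}{M_1}$. For scalar angular momentum $L$ (scaled by $\frac1{M_1M_2}$) the amended potential (same scaling) is $$V(r,\theta)=\frac{L^2}{2(r^2+B)}-\frac{x_1}{d_1}-\frac{x_2}{d_2}.$$ A relative equilibrium (RE) with angular momentum $L$ is a critical point $(r,\theta)$, $r>0$, of $V$, i.e. $\partial_rV=\partial_\theta V=0$. RE at a given $L$ are counted by the number of such points $(r,\theta)$. *)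

theory Defs
  imports Complex_Main
begin

(* Planar dumbbell/point mass problem (G = 1, total mass 1, rod length 1).
   The point mass body has mass M1; the dumbbell has mass M2 = 1 - M1, split into
   M2 x1 and M2 x2.  Energy and angular momentum are scaled by 1/(M1 M2), so M2
   does not occur in the formulas below.  In (r, \<theta>), r is the distance from the
   point mass body to the dumbbell's center of mass and \<theta> the angle between that
   vector and the rod, the mass x1 facing the point mass body at \<theta> = 0. *)

definition dist1 :: "real \<Rightarrow> real \<Rightarrow> real \<Rightarrow> real" where
  "dist1 x2 r \<theta> = sqrt (r\<^sup>2 - 2 * x2 * r * cos \<theta> + x2\<^sup>2)"

definition dist2 :: "real \<Rightarrow> real \<Rightarrow> real \<Rightarrow> real" where
  "dist2 x1 r \<theta> = sqrt (r\<^sup>2 + 2 * x1 * r * cos \<theta> + x1\<^sup>2)"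

definition B_const :: "real \<Rightarrow> real \<Rightarrow> real \<Rightarrow> real" where
  "B_const x1 x2 M1 = x1 * x2 / M1"

definition amended_potential ::
  "real \<Rightarrow> real \<Rightarrow> real \<Rightarrow> real \<Rightarrow> real \<Rightarrow> real \<Rightarrow> real" where
  "amended_potential x1 x2 M1 L r \<theta> =
     L\<^sup>2 / (2 * (r\<^sup>2 + B_const x1 x2 M1)) - x1 / dist1 x2 r \<theta> - x2 / dist2 x1 r \<theta>"

(* Both partial derivatives are required to exist and vanish; "deriv" would give an
   unspecified value at the collision points, where the potential is singular. *)

definition relative_equilibrium ::
  "real \<Rightarrow> real \<Rightarrow> real \<Rightarrow> real \<Rightarrow> real \<times> real \<Rightarrow> bool" where
  "relative_equilibrium x1 x2 M1 L = (\<lambda>(r, \<theta>). r > 0 \<and>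
     ((\<lambda>s. amended_potential x1 x2 M1 L s \<theta>) has_real_derivative 0) (at r) \<and>
     ((\<lambda>t. amended_potential x1 x2 M1 L r t) has_real_derivative 0) (at \<theta>))"

definition colinear_nonoverlapped_RE ::
  "real \<Rightarrow> real \<Rightarrow> real \<Rightarrow> real \<Rightarrow> (real \<times> real) set" where
  "colinear_nonoverlapped_RE x1 x2 M1 L =
     {(r, \<theta>). relative_equilibrium x1 x2 M1 L (r, \<theta>) \<and> \<theta> = 0 \<and> r > x2}"

end

theory Submission
  imports Defs
begin

text \<open>
  At \<open>\<theta> = 0\<close> the potential is stationary in \<open>\<theta>\<close> by symmetry, so the relative equilibria with
  \<open>r > x\<^sub>2\<close> are the solutions of \<open>L\<^sup>2 = G r\<close>, where
  \<open>G r = (r\<^sup>2 + B)\<^sup>2 / r * (x\<^sub>1 / (r - x\<^sub>2)\<^sup>2 + x\<^sub>2 / (r + x\<^sub>1)\<^sup>2)\<close>.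
  Since \<open>G r \<ge> x\<^sub>1 r\<close>, there are none for \<open>L\<^sup>2 < x\<^sub>1 x\<^sub>2\<close>. Moreover \<open>G\<close> tends to infinity at both
  ends of the interval \<open>r > x\<^sub>2\<close> and is strictly convex there, so it takes every value above
  \<open>G (x\<^sub>2 + 1)\<close> exactly twice.
\<close>

section \<open>Real analysis: level sets and inverse powers\<close>

text \<open>Existence: \<open>g\<close> lies below \<open>c\<close> at \<open>m\<close> and reaches
  \<open>c\<close> towards both ends, so the intermediate value theorem gives a solution on each
  side of \<open>m\<close>. Uniqueness: a third solution would, by Rolle, give two zeros of the
  strictly increasing \<open>g'\<close>.\<close>

lemma strictly_convex_level_set_card_two:
  fixes g g' g'' :: "real \<Rightarrow> real"
  assumes g': "\<And>x. a < x \<Longrightarrow> (g has_real_derivative g' x) (at x)"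
    and g'': "\<And>x. a < x \<Longrightarrow> (g' has_real_derivative g'' x) (at x)"
    and pos: "\<And>x. a < x \<Longrightarrow> g'' x > 0"
    and left: "filterlim g at_top (at_right a)"
    and right: "filterlim g at_top at_top"
    and m: "a < m" "g m < c"
  shows "card {x. a < x \<and> g x = c} = 2"
proof -
  have cont: "continuous_on {x..y} g" if "a < x" for x y
    using that by (intro continuous_at_imp_continuous_on) (auto intro!: DERIV_isCont[OF g'])
  obtain p where p: "a < p" "p < m" "c \<le> g p"
  proof -
    have "eventually (\<lambda>x. c \<le> g x) (at_right a)"
      using left by (simp add: filterlim_at_top)
    moreover have "eventually (\<lambda>x. x \<in> {a<..<m}) (at_right a)"
      using m(1) by (rule eventually_at_right_real)
    ultimately have "eventually (\<lambda>x. c \<le> g x \<and> x \<in> {a<..<m}) (at_right a)"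
      by (rule eventually_conj)
    then have "\<exists>x. c \<le> g x \<and> x \<in> {a<..<m}"
      by (rule eventually_happens'[rotated]) simp
    then show thesis using that by auto
  qed
  obtain q where q: "m < q" "c \<le> g q"
  proof -
    have "eventually (\<lambda>x. c \<le> g x) at_top"
      using right by (simp add: filterlim_at_top)
    then have "eventually (\<lambda>x. c \<le> g x \<and> m < x) at_top"
      using eventually_gt_at_top by (rule eventually_conj)
    then have "\<exists>x. c \<le> g x \<and> m < x"
      by (rule eventually_happens'[rotated]) simp
    then show thesis using that by auto
  qed
  obtain x where x: "p \<le> x" "x \<le> m" "g x = c"
    using IVT2'[of g m c p] p m cont[of p m] by auto
  obtain y where y: "m \<le> y" "y \<le> q" "g y = c"
    using IVT'[of g m c q] q m cont[of m q] by auto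
  have xy: "a < x" "x < y"
    using x y p m by (auto simp: order_less_le)
  have crit: "\<exists>s. u < s \<and> s < v \<and> g' s = 0" if uv: "a < u" "u < v" "g u = g v" for u v
  proof -
    have "g differentiable (at s)" if "u < s" for s
      using g'[of s] \<open>a < u\<close> that by (auto simp: real_differentiable_def)
    then obtain s where "u < s" "s < v" "(g has_real_derivative 0) (at s)"
      using Rolle[of u v g] uv cont[of u v] by blast
    then show ?thesis
      using DERIV_unique[OF _ g'[of s]] \<open>a < u\<close> by force
  qed
  have no_three: False if uvw: "a < u" "u < v" "v < w" "g u = c" "g v = c" "g w = c" for u v w
  proof -
    obtain s where s: "u < s" "s < v" "g' s = 0" using crit[of u v] uvw by auto
    obtain t where t: "v < t" "t < w" "g' t = 0" using crit[of v w] uvw by auto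
    have "g' s < g' t"
    proof (rule DERIV_pos_imp_increasing[where f = g'])
      fix x assume "s \<le> x"
      then have "a < x" using s uvw by linarith
      then show "\<exists>y. (g' has_real_derivative y) (at x) \<and> 0 < y" using g'' pos by blast
    qed (use s t in linarith)
    then show False using s t by simp
  qed
  have "{z. a < z \<and> g z = c} = {x, y}"
  proof (intro equalityI subsetI)
    fix z assume "z \<in> {z. a < z \<and> g z = c}"
    then show "z \<in> {x, y}"
      using no_three[of x y z] no_three[of x z y] no_three[of z x y] x y xy
      by (cases z x rule: linorder_cases; cases z y rule: linorder_cases) auto
  qed (use x y xy in auto)
  then show ?thesis using xy by simp
qed

text \<open>The power rule in a form that stays inside the family of shifted inverse powers, so it
  can be applied again for the second derivative.\<close>

lemma has_real_derivative_inverse_shift_power: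
  fixes k :: real
  assumes "r + k \<noteq> 0"
  shows "((\<lambda>r. 1 / (r + k) ^ n) has_real_derivative - (real n / (r + k) ^ Suc n)) (at r)"
proof (cases n)
  case (Suc m)
  define z where "z = r + k"
  have "((\<lambda>r. inverse ((r + k) ^ n)) has_real_derivative
      - (inverse (z ^ n) * (real n * z ^ m) * inverse (z ^ n))) (at r)"
    using assms unfolding z_def
    by - (rule DERIV_inverse', rule DERIV_cong, (rule derivative_intros)+, simp_all add: Suc)
  moreover have "inverse (z ^ n) * (real n * z ^ m) * inverse (z ^ n) = real n / z ^ Suc n"
  proof -
    have "z \<noteq> 0" using assms by (simp add: z_def)
    then show ?thesis by (simp add: Suc field_simps)
  qed
  ultimately show ?thesis by (simp add: inverse_eq_divide z_def)
qed simp

section \<open>Reduction of the equilibria to a level set\<close>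

text \<open>The function \<open>G\<close> of the overview: the radial equation at \<theta> = 0
  solved for \<open>L\<^sup>2\<close>.\<close>

definition momentum_sq :: "real \<Rightarrow> real \<Rightarrow> real \<Rightarrow> real \<Rightarrow> real" where
  "momentum_sq x1 x2 B r = (r\<^sup>2 + B)\<^sup>2 / r * (x1 / (r - x2)\<^sup>2 + x2 / (r + x1)\<^sup>2)"

lemma colinear_nonoverlapped_RE_iff:
  assumes "0 < x1" "0 < x2" "0 < B_const x1 x2 M1"
  shows "(r, \<theta>) \<in> colinear_nonoverlapped_RE x1 x2 M1 L \<longleftrightarrow>
    \<theta> = 0 \<and> x2 < r \<and> momentum_sq x1 x2 (B_const x1 x2 M1) r = L\<^sup>2"
proof (cases "\<theta> = 0 \<and> x2 < r")
  case True
  define B where "B = B_const x1 x2 M1"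
  have B: "B > 0" using assms B_def by simp
  have r: "r > x2" "r > 0" using True assms by auto
  have d1: "dist1 x2 s 0 = s - x2" if "s > x2" for s
    using that real_sqrt_abs[of "s - x2"] by (simp add: dist1_def power2_eq_square algebra_simps)
  have d2: "dist2 x1 s 0 = s + x1" if "s > x2" for s
    using that assms real_sqrt_abs[of "s + x1"]
    by (simp add: dist2_def power2_eq_square algebra_simps)
  \<comment> \<open>The radial derivative of the potential on the ray \<theta> = 0.\<close>
  let ?D = "x1 / (r - x2)\<^sup>2 + x2 / (r + x1)\<^sup>2 - L\<^sup>2 * r / (r\<^sup>2 + B)\<^sup>2"
  have pos: "r\<^sup>2 + B > 0" using B by (simp add: add_nonneg_pos)
  have "((\<lambda>s. L\<^sup>2 / (2 * (s\<^sup>2 + B))) has_real_derivative - (L\<^sup>2 * r / (r\<^sup>2 + B)\<^sup>2)) (at r)"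
    by (rule DERIV_cong, (rule derivative_intros)+)
       (use pos in \<open>auto simp: power2_eq_square divide_simps simp del: distrib_left_numeral\<close>)
  moreover have "((\<lambda>s. x1 / (s - x2)) has_real_derivative - (x1 / (r - x2)\<^sup>2)) (at r)"
    by (rule DERIV_cong, (rule derivative_intros)+) (use r in \<open>auto simp: power2_eq_square\<close>)
  moreover have "((\<lambda>s. x2 / (s + x1)) has_real_derivative - (x2 / (r + x1)\<^sup>2)) (at r)"
    by (rule DERIV_cong, (rule derivative_intros)+) (use r assms in \<open>auto simp: power2_eq_square\<close>)
  ultimately have "((\<lambda>s. L\<^sup>2 / (2 * (s\<^sup>2 + B)) - x1 / (s - x2) - x2 / (s + x1))
      has_real_derivative ?D) (at r)"
    by (rule DERIV_cong[OF DERIV_diff[OF DERIV_diff]]) simp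
  \<comment> \<open>The distances are \<open>s - x2\<close> and \<open>s + x1\<close> only for
    \<open>s > x2\<close>, so the potential is replaced on that open set.\<close>
  then have Vr: "((\<lambda>s. amended_potential x1 x2 M1 L s 0) has_real_derivative ?D) (at r)"
    by (rule has_field_derivative_transform_within_open[of _ _ _ "{x2<..}"])
       (use r d1 d2 in \<open>auto simp: amended_potential_def B_def\<close>)
  \<comment> \<open>The radicands at \<theta> = 0 are the squares of \<open>r - x2\<close> and
    \<open>r + x1\<close>. Being positive, they make the square roots differentiable, and
    \<open>sin 0 = 0\<close> kills the derivative.\<close>
  have "r\<^sup>2 - 2 * x2 * r + x2\<^sup>2 > 0" "r\<^sup>2 + 2 * x1 * r + x1\<^sup>2 > 0"
    using r assms zero_less_power[of "r - x2" 2] zero_less_power[of "r + x1" 2]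
    by (simp_all add: power2_eq_square algebra_simps)
  then have V\<theta>: "((\<lambda>t. amended_potential x1 x2 M1 L r t) has_real_derivative 0) (at 0)"
    unfolding amended_potential_def dist1_def dist2_def
    by (auto intro!: derivative_eq_intros)
  have "(r, \<theta>) \<in> colinear_nonoverlapped_RE x1 x2 M1 L \<longleftrightarrow> ?D = 0"
    using True r Vr V\<theta> DERIV_unique[OF Vr, of 0]
    by (auto simp: colinear_nonoverlapped_RE_def relative_equilibrium_def)
  also have "\<dots> \<longleftrightarrow> x1 / (r - x2)\<^sup>2 + x2 / (r + x1)\<^sup>2 = L\<^sup>2 * r / (r\<^sup>2 + B)\<^sup>2"
    by simp
  also have "\<dots> \<longleftrightarrow> momentum_sq x1 x2 B r = L\<^sup>2"
  proof -
    have "A = l * r / q \<longleftrightarrow> q / r * A = l" if "q \<noteq> 0" for A l q :: real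
      using that r by (auto simp: field_simps)
    from this[of "(r\<^sup>2 + B)\<^sup>2"] show ?thesis using pos by (simp add: momentum_sq_def)
  qed
  finally show ?thesis using True B_def by simp
qed (auto simp: colinear_nonoverlapped_RE_def)

section \<open>Lower bounds and behaviour at both ends\<close>

text \<open>Dropping \<open>B\<close> and the \<open>x2\<close> term only decreases the value. What
  remains keeps the double pole at \<open>r = x2\<close>.\<close>

lemma momentum_sq_ge:
  assumes "0 < x1" "0 < x2" "x2 < r" "0 < B"
  shows "x1 * r ^ 3 / (r - x2)\<^sup>2 \<le> momentum_sq x1 x2 B r"
proof -
  have "x1 * r ^ 3 / (r - x2)\<^sup>2 = (r\<^sup>2)\<^sup>2 / r * (x1 / (r - x2)\<^sup>2)"
    using assms by (simp add: power2_eq_square power3_eq_cube)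
  also have "\<dots> \<le> momentum_sq x1 x2 B r"
    unfolding momentum_sq_def using assms
    by (intro mult_mono divide_right_mono power_mono) auto
  finally show ?thesis .
qed

text \<open>Used twice: for growth at infinity and to exclude equilibria at low
  \<open>L\<close>.\<close>

lemma momentum_sq_ge_linear:
  assumes "0 < x1" "0 < x2" "x2 < r" "0 < B"
  shows "x1 * r \<le> momentum_sq x1 x2 B r"
proof -
  have "(r - x2)\<^sup>2 \<le> r\<^sup>2"
    using assms by (intro power_mono) auto
  then have "x1 * r * (r - x2)\<^sup>2 \<le> x1 * r * r\<^sup>2"
    using assms by (intro mult_left_mono) auto
  then have "x1 * r \<le> x1 * r ^ 3 / (r - x2)\<^sup>2"
    using assms by (simp add: pos_le_divide_eq power2_eq_square power3_eq_cube mult_ac)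
  then show ?thesis using momentum_sq_ge[OF assms] by linarith
qed

lemma momentum_sq_at_top:
  assumes "0 < x1" "0 < x2" "0 < B"
  shows "filterlim (momentum_sq x1 x2 B) at_top at_top"
proof (rule filterlim_at_top_mono)
  show "filterlim (\<lambda>r. x1 * r) at_top at_top"
    using assms by (intro filterlim_tendsto_pos_mult_at_top[OF tendsto_const]) (auto simp: filterlim_ident)
  show "eventually (\<lambda>r. x1 * r \<le> momentum_sq x1 x2 B r) at_top"
    by (rule eventually_mono[OF eventually_gt_at_top[of x2]])
       (use momentum_sq_ge_linear assms in auto)
qed

lemma momentum_sq_at_right:
  assumes "0 < x1" "0 < x2" "0 < B"
  shows "filterlim (momentum_sq x1 x2 B) at_top (at_right x2)"
proof (rule filterlim_at_top_mono)
  \<comment> \<open>The square tends to 0 through positive values, so its inverse tends to plus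
    infinity, while the numerator tends to \<open>x1 * x2 ^ 3 > 0\<close>.\<close>
  have "filterlim (\<lambda>r. (r - x2)\<^sup>2) (at_right 0) (at_right x2)"
    unfolding filterlim_at
  proof
    have "((\<lambda>r. (r - x2)\<^sup>2) \<longlongrightarrow> (x2 - x2)\<^sup>2) (at_right x2)"
      by (intro tendsto_intros)
    then show "((\<lambda>r. (r - x2)\<^sup>2) \<longlongrightarrow> 0) (at_right x2)" by simp
  qed (auto simp: eventually_at_filter)
  then show "filterlim (\<lambda>r. x1 * r ^ 3 / (r - x2)\<^sup>2) at_top (at_right x2)"
    unfolding divide_inverse using assms
    by (intro filterlim_tendsto_pos_mult_at_top[where c = "x1 * x2 ^ 3"] tendsto_intros
        filterlim_compose[OF filterlim_inverse_at_top_right]) auto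
  show "eventually (\<lambda>r. x1 * r ^ 3 / (r - x2)\<^sup>2 \<le> momentum_sq x1 x2 B r) (at_right x2)"
    using momentum_sq_ge assms by (auto simp: eventually_at_filter)
qed

text \<open>
  The witnesses come from the partial fraction decomposition of \<open>G\<close> in
  \<open>s = r - x\<^sub>2\<close> and \<open>u = r + x\<^sub>1\<close>, where \<open>1 / (r s\<^sup>2)\<close> and \<open>1 / (r u\<^sup>2)\<close>, being visibly convex,
  are kept as products. The only terms of the second derivative with the wrong sign are the last
  one in \<open>x\<^sub>2\<close>, dominated because \<open>x\<^sub>1 < u\<close>, and the last one in \<open>2 B\<close>, dominated because \<open>s < u\<close>.
\<close>

lemma momentum_sq_second_derivative_pos:
  assumes "0 < x1" "0 < x2" "x1 + x2 = 1" "0 < B"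
  obtains G' G'' :: "real \<Rightarrow> real" where
    "\<And>r. x2 < r \<Longrightarrow> (momentum_sq x1 x2 B has_real_derivative G' r) (at r)"
    "\<And>r. x2 < r \<Longrightarrow> (G' has_real_derivative G'' r) (at r)"
    "\<And>r. x2 < r \<Longrightarrow> G'' r > 0"
proof -
  \<comment> \<open>All three families are written with an additive shift, even \<open>- x2\<close>
    and \<open>0\<close>, to match the power rule above.\<close>
  define P where "P n = (\<lambda>r :: real. 1 / (r + - x2) ^ n)" for n
  define Q where "Q n = (\<lambda>r :: real. 1 / (r + x1) ^ n)" for n
  define R where "R n = (\<lambda>r :: real. 1 / (r + 0) ^ n)" for n
  have P': "(P n has_real_derivative - (real n * P (Suc n) r)) (at r)" if "x2 < r" for n r
    using has_real_derivative_inverse_shift_power[of r "- x2" n] that by (simp add: P_def)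
  have Q': "(Q n has_real_derivative - (real n * Q (Suc n) r)) (at r)" if "x2 < r" for n r
    using has_real_derivative_inverse_shift_power[of r x1 n] that assms by (simp add: Q_def)
  have R': "(R n has_real_derivative - (real n * R (Suc n) r)) (at r)" if "x2 < r" for n r
    using has_real_derivative_inverse_shift_power[of r 0 n] that assms by (simp add: R_def)
  define G0 where "G0 r =
      x1 * ((r - x2) + 3 * x2 + 3 * x2^2 * P 1 r + x2^3 * P 2 r)
    + x2 * ((r + x1) - 3 * x1 + 3 * x1^2 * Q 1 r - x1^3 * Q 2 r)
    + 2 * B * (x1 * P 1 r + x1 * x2 * P 2 r + x2 * Q 1 r - x1 * x2 * Q 2 r)
    + B^2 * (R 1 r * (x1 * P 2 r + x2 * Q 2 r))" for r
  define G1 where "G1 r =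
      x1 * (1 - 3 * x2^2 * P 2 r - 2 * x2^3 * P 3 r)
    + x2 * (1 - 3 * x1^2 * Q 2 r + 2 * x1^3 * Q 3 r)
    - 2 * B * (x1 * P 2 r + 2 * x1 * x2 * P 3 r + x2 * Q 2 r - 2 * x1 * x2 * Q 3 r)
    - B^2 * (R 2 r * (x1 * P 2 r + x2 * Q 2 r) + 2 * R 1 r * (x1 * P 3 r + x2 * Q 3 r))" for r
  define G2 where "G2 r =
      x1 * (6 * x2^2 * P 3 r + 6 * x2^3 * P 4 r)
    + x2 * (6 * x1^2 * Q 3 r - 6 * x1^3 * Q 4 r)
    + 2 * B * (2 * x1 * P 3 r + 2 * x2 * Q 3 r + 6 * x1 * x2 * (P 4 r - Q 4 r))
    + B^2 * (2 * R 3 r * (x1 * P 2 r + x2 * Q 2 r) + 4 * R 2 r * (x1 * P 3 r + x2 * Q 3 r)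
           + 6 * R 1 r * (x1 * P 4 r + x2 * Q 4 r))" for r
  note PQR' = P'[THEN DERIV_cong] Q'[THEN DERIV_cong] R'[THEN DERIV_cong]
  have G0: "momentum_sq x1 x2 B r = G0 r" if "x2 < r" for r
  proof -
    \<comment> \<open>Expand the square, divide by \<open>r\<close>, and substitute
      \<open>r = s + a\<close> in \<open>r^3 / s^2\<close> and \<open>r / s^2\<close>. The cases
      \<open>a = x2\<close> and \<open>a = - x1\<close> give the two terms of
      \<open>G\<close>.\<close>
    have part: "(r\<^sup>2 + B)\<^sup>2 / r * (1 / (r - a)\<^sup>2) =
        (r - a) + 3 * a + 3 * a^2 * (1 / (r - a)) + a^3 * (1 / (r - a)\<^sup>2)
      + 2 * B * (1 / (r - a) + a * (1 / (r - a)\<^sup>2)) + B^2 * (1 / r * (1 / (r - a)\<^sup>2))"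
      if "r - a \<noteq> 0" "r \<noteq> 0" for a
    proof -
      define s where "s = r - a"
      have "a = r - s" "s \<noteq> 0" using that by (auto simp: s_def)
      then show ?thesis using that(2)
        by (simp add: divide_simps) (simp add: algebra_simps power2_eq_square power3_eq_cube)
    qed
    have "momentum_sq x1 x2 B r =
      x1 * ((r\<^sup>2 + B)\<^sup>2 / r * (1 / (r - x2)\<^sup>2)) + x2 * ((r\<^sup>2 + B)\<^sup>2 / r * (1 / (r - (- x1))\<^sup>2))"
      by (simp add: momentum_sq_def algebra_simps)
    also have "\<dots> = G0 r"
    proof -
      \<comment> \<open>With the reciprocals treated as atoms, the claim becomes a polynomial
        identity.\<close>
      have PQR: "1 / (r - x2) = P 1 r" "1 / (r - x2)\<^sup>2 = P 2 r"
        "1 / (r - - x1) = Q 1 r" "1 / (r - - x1)\<^sup>2 = Q 2 r" "1 / r = R 1 r"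
        by (simp_all add: P_def Q_def R_def)
      have "r - x2 \<noteq> 0" "r - - x1 \<noteq> 0" "r \<noteq> 0" using that assms by auto
      from part[OF this(1,3)] part[OF this(2,3)] show ?thesis
        unfolding PQR G0_def by algebra
    qed
    finally show ?thesis .
  qed
  have G0': "(G0 has_real_derivative G1 r) (at r)" if "x2 < r" for r
    unfolding G0_def G1_def
    by (rule derivative_eq_intros PQR' that refl)+
       (simp add: eval_nat_numeral algebra_simps)
  show thesis
  proof
    fix r assume r: "x2 < r"
    show "(momentum_sq x1 x2 B has_real_derivative G1 r) (at r)"
      by (rule has_field_derivative_transform_within_open[OF G0'[OF r], of "{x2<..}"])
         (use r G0 in auto)
    show "(G1 has_real_derivative G2 r) (at r)"
      unfolding G1_def G2_def
      by (rule derivative_eq_intros PQR' r refl)+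
         (simp add: eval_nat_numeral algebra_simps)
    have pos: "P n r > 0" "Q n r > 0" "R n r > 0" for n
      using r assms by (simp_all add: P_def Q_def R_def)
    have "x1 * Q 4 r \<le> (r + x1) * Q 4 r"
      using r assms pos by (intro mult_right_mono) (auto simp: less_imp_le)
    also have "\<dots> = Q 3 r"
      using r assms by (simp add: Q_def eval_nat_numeral)
    finally have "6 * x1\<^sup>2 * (x1 * Q 4 r) \<le> 6 * x1\<^sup>2 * Q 3 r"
      by (intro mult_left_mono) auto
    then have Q: "6 * x1^2 * Q 3 r - 6 * x1^3 * Q 4 r \<ge> 0"
      by (simp add: power2_eq_square power3_eq_cube mult_ac)
    have PQ: "P 4 r - Q 4 r \<ge> 0"
      using r assms by (auto simp: P_def Q_def intro!: divide_left_mono power_mono mult_pos_pos)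
    show "G2 r > 0"
      unfolding G2_def using assms pos Q PQ
      by (intro add_pos_pos add_pos_nonneg add_nonneg_pos mult_pos_pos mult_nonneg_nonneg
          zero_less_power) (auto simp: less_imp_le)
  qed
qed

theorem theorem4p3p2:
  fixes x1 x2 M1 M2 :: real
  assumes "0 < x1" "x1 < 1" "0 < x2" "x2 < 1" "x1 + x2 = 1"
    and "0 < M1" "M1 < 1" "0 < M2" "M2 < 1" "M1 + M2 = 1"
  shows "(\<exists>L0>0. \<forall>L. 0 \<le> L \<and> L < L0 \<longrightarrow> colinear_nonoverlapped_RE x1 x2 M1 L = {}) \<and>
         (\<exists>Lb>0. \<forall>L>Lb. card (colinear_nonoverlapped_RE x1 x2 M1 L) = 2)"
proof
  let ?B = "B_const x1 x2 M1"
  let ?G = "momentum_sq x1 x2 ?B"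
  have B: "?B > 0" using assms by (simp add: B_const_def)
  note iff = colinear_nonoverlapped_RE_iff[OF \<open>0 < x1\<close> \<open>0 < x2\<close> B]
  show "\<exists>L0>0. \<forall>L. 0 \<le> L \<and> L < L0 \<longrightarrow> colinear_nonoverlapped_RE x1 x2 M1 L = {}"
  proof (intro exI conjI allI impI)
    \<comment> \<open>The threshold comes from \<open>x1 * r > x1 * x2\<close> on
      \<open>r > x2\<close>.\<close>
    show "sqrt (x1 * x2) > 0" using assms by simp
    fix L assume L: "0 \<le> L \<and> L < sqrt (x1 * x2)"
    then have "L\<^sup>2 < (sqrt (x1 * x2))\<^sup>2" by (intro power_strict_mono) auto
    then have L2: "L\<^sup>2 < x1 * x2" using assms by simp
    have "?G r \<noteq> L\<^sup>2" if "x2 < r" for r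
    proof -
      have "x1 * x2 < x1 * r" using that assms by simp
      also have "\<dots> \<le> ?G r" using momentum_sq_ge_linear that assms B by blast
      finally show ?thesis using L2 by simp
    qed
    then show "colinear_nonoverlapped_RE x1 x2 M1 L = {}" using iff by auto
  qed
  show "\<exists>Lb>0. \<forall>L>Lb. card (colinear_nonoverlapped_RE x1 x2 M1 L) = 2"
  proof (intro exI conjI allI impI)
    \<comment> \<open>The point \<open>x2 + 1\<close> is an arbitrary sample of the interval; any
      \<open>L\<^sup>2\<close> above the value of \<open>G\<close> there is a level with two
      solutions.\<close>
    have "x1 * (x2 + 1) \<le> ?G (x2 + 1)"
      using assms B by (intro momentum_sq_ge_linear) auto
    moreover have "x1 * (x2 + 1) > 0" using assms by simp
    ultimately have Gpos: "?G (x2 + 1) > 0" by linarith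
    then show "sqrt (?G (x2 + 1)) > 0" by simp
    fix L assume L: "L > sqrt (?G (x2 + 1))"
    then have "(sqrt (?G (x2 + 1)))\<^sup>2 < L\<^sup>2"
      using Gpos by (intro power_strict_mono) auto
    then have L2: "?G (x2 + 1) < L\<^sup>2" using Gpos by simp
    obtain G' G'' where G:
      "\<And>r. x2 < r \<Longrightarrow> (?G has_real_derivative G' r) (at r)"
      "\<And>r. x2 < r \<Longrightarrow> (G' has_real_derivative G'' r) (at r)"
      "\<And>r. x2 < r \<Longrightarrow> G'' r > 0"
      using momentum_sq_second_derivative_pos assms B by metis
    have "card {r. x2 < r \<and> ?G r = L\<^sup>2} = 2"
      using momentum_sq_at_right momentum_sq_at_top assms B L2
      by (intro strictly_convex_level_set_card_two[OF G, where m = "x2 + 1"]) auto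
    \<comment> \<open>The angle is fixed at 0, so equilibria correspond bijectively to solutions
      \<open>r\<close>.\<close>
    moreover have "colinear_nonoverlapped_RE x1 x2 M1 L =
        (\<lambda>r. (r, 0)) ` {r. x2 < r \<and> ?G r = L\<^sup>2}"
      using iff by auto
    ultimately show "card (colinear_nonoverlapped_RE x1 x2 M1 L) = 2"
      by (simp add: card_image inj_on_def)
  qed
qed

end
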